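(* Let $P$ be a reflexive cone of a Banach space $X$. If $P$ has an unbounded base defined by some $x^*\in X^*$, then $P$ contains a normalized basic sequence $\{x_n\}$ which converges weakly to zero.
   Context: All spaces are real. $B_X$ is the closed unit ball of $X$. A cone of $X$ is a nonempty convex set $P\subseteq X$ with $\lambda P\subseteq P$ for every real $\lambda\ge 0$. A cone $P$ of a Banach space $X$ is reflexive if $P\cap B_X$ is weakly compact. A functional $x^*\in X^*$ is strictly positive on $P$ if $x^*(x)>0$ for each $x\in P\setminus\{0\}$; in that case the base for $P$ defined by $x^*$ is $B_{x^*}=\{x\in P: x^*(x)=1\}$. Saying that $P$ has a base defined by $x^*$ means that $x^*$ is strictly positive on $P$ and the base is $B_{x^*}$. A basic sequence is a sequence that is a Schauder basis of its closed linear span; it is normalized if each term has norm $1$. *)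

theory Defs
  imports "HOL-Analysis.Analysis"
begin

text \<open>The weak topology is the initial topology with respect to all bounded functionals: the
  pullback, along evaluation, of the product topology on real-valued functions on the dual.\<close>

definition weak_topology :: "'a::real_normed_vector topology"
  where "weak_topology =
    pullback_topology UNIV (\<lambda>x (f :: 'a \<Rightarrow>\<^sub>L real). blinfun_apply f x) euclidean"

lemma topspace_weak_topology [simp]: "topspace weak_topology = UNIV"
  by (simp add: weak_topology_def topspace_pullback_topology)

lemma limitin_weak_topology_iff:
  fixes l :: "'a::real_normed_vector"
  shows "limitin weak_topology x l F \<longleftrightarrow>
    (\<forall>f :: 'a \<Rightarrow>\<^sub>L real. ((\<lambda>n. blinfun_apply f (x n)) \<longlongrightarrow> blinfun_apply f l) F)"
proof -
  let ?ev = "\<lambda>y (f :: 'a \<Rightarrow>\<^sub>L real). blinfun_apply f y"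
  have "limitin weak_topology x l F \<longleftrightarrow> ((\<lambda>n. ?ev (x n)) \<longlongrightarrow> ?ev l) F"
    unfolding limitin_def weak_topology_def topspace_pullback_topology tendsto_def
      openin_pullback_topology by auto
  also have "\<dots> \<longleftrightarrow> limitin (product_topology (\<lambda>_. euclidean) UNIV) (\<lambda>n. ?ev (x n)) (?ev l) F"
    by (simp add: euclidean_product_topology)
  also have "\<dots> \<longleftrightarrow> (\<forall>f. ((\<lambda>n. ?ev (x n) f) \<longlongrightarrow> ?ev l f) F)"
    by (simp add: limitin_componentwise)
  finally show ?thesis .
qed

definition reflexive_cone :: "'a::real_normed_vector set \<Rightarrow> bool"
  where "reflexive_cone P \<longleftrightarrow> convex_cone P \<and> compactin weak_topology (P \<inter> cball 0 1)"

definition strictly_positive_on :: "('a::real_normed_vector \<Rightarrow>\<^sub>L real) \<Rightarrow> 'a set \<Rightarrow> bool"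
  where "strictly_positive_on f P \<longleftrightarrow> (\<forall>x\<in>P - {0}. blinfun_apply f x > 0)"

definition cone_base :: "('a::real_normed_vector \<Rightarrow>\<^sub>L real) \<Rightarrow> 'a set \<Rightarrow> 'a set"
  where "cone_base f P = {x \<in> P. blinfun_apply f x = 1}"

definition schauder_basis_of :: "(nat \<Rightarrow> 'a::real_normed_vector) \<Rightarrow> 'a set \<Rightarrow> bool"
  where "schauder_basis_of e Y \<longleftrightarrow>
    range e \<subseteq> Y \<and> (\<forall>y\<in>Y. \<exists>!a :: nat \<Rightarrow> real. (\<lambda>n. a n *\<^sub>R e n) sums y)"

definition basic_sequence :: "(nat \<Rightarrow> 'a::real_normed_vector) \<Rightarrow> bool"
  where "basic_sequence e \<longleftrightarrow> schauder_basis_of e (closure (span (range e)))"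

end

theory Submission
  imports Defs
begin

text \<open>
  Dividing the elements of an unbounded base by their norms gives unit vectors \<open>y n\<close> of the cone
  on which \<open>f\<close> tends to \<open>0\<close>. They lie in the weakly compact set \<open>K = P \<inter> cball 0 1\<close>, whose only
  zero of \<open>f\<close> is the origin. For any functional \<open>g\<close> and \<open>e > 0\<close>, the part of \<open>K\<close> where
  \<open>\<bar>g\<bar> \<ge> e\<close> is weakly compact and \<open>f\<close> is positive on it, hence bounded away from \<open>0\<close>; so
  \<open>y n\<close> eventually leaves this part. Thus the whole sequence is weakly null
  (\<open>weakly_null_in_weakly_compact\<close>).

  The rest is the selection principle of Bessaga and Pelczynski: a weakly null normalized sequence
  has a basic subsequence (\<open>weakly_null_has_basic_subsequence\<close>). By Mazur's lemma
  (\<open>mazur_finite_dimensional\<close>), far members of the sequence are almost orthogonal to a given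
  finite-dimensional subspace, in the sense that adding a multiple of one of them shrinks no vector of the
  subspace by more than a factor as close to \<open>1\<close> as desired. A subsequence chosen inductively, with
  factors whose products stay bounded, has partial sums that dominate all shorter ones up to a
  constant. By Grunblum's criterion (\<open>basic_sequence_if_partial_sums_dominated\<close>) it is basic.

  Mazur's lemma combines compactness of finite-dimensional balls (\<open>compact_span_Int_cball\<close>) with
  the existence of norming functionals (\<open>norming_functional\<close>), a case of the Hahn-Banach theorem,
  which is proved here by taking minimal sublinear functionals.
\<close>

section \<open>The Hahn-Banach theorem for sublinear functionals\<close>

definition sublinear :: "('a::real_vector \<Rightarrow> real) \<Rightarrow> bool"
  where "sublinear q \<longleftrightarrow> (\<forall>x y. q (x + y) \<le> q x + q y) \<and> (\<forall>t x. 0 \<le> t \<longrightarrow> q (t *\<^sub>R x) = t * q x)"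

lemma sublinear_add: "sublinear q \<Longrightarrow> q (x + y) \<le> q x + q y"
  and sublinear_scaleR: "sublinear q \<Longrightarrow> 0 \<le> t \<Longrightarrow> q (t *\<^sub>R x) = t * q x"
  by (auto simp: sublinear_def)

lemma sublinear_zero: "sublinear q \<Longrightarrow> q 0 = 0"
  using sublinear_scaleR[of q 0 0] by simp

lemma sublinear_minus: "sublinear q \<Longrightarrow> - q (- x) \<le> q x"
  using sublinear_add[of q x "- x"] sublinear_zero[of q] by simp

lemma sublinearI:
  assumes add: "\<And>x y. q (x + y) \<le> q x + q y"
    and zero: "q 0 = 0"
    and scale: "\<And>t x. 0 < t \<Longrightarrow> q (t *\<^sub>R x) \<le> t * q x"
  shows "sublinear q"
proof -
  have "q (t *\<^sub>R x) = t * q x" if "0 \<le> t" for t x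
  proof (cases "t = 0")
    case False
    with that have t: "0 < t" by simp
    have "q x \<le> inverse t * q (t *\<^sub>R x)"
      using scale[of "inverse t" "t *\<^sub>R x"] t by simp
    then have "t * q x \<le> q (t *\<^sub>R x)"
      using t by (simp add: field_simps)
    with scale[OF t, of x] show ?thesis by simp
  qed (simp add: zero)
  with add show ?thesis by (simp add: sublinear_def)
qed

lemma sublinear_norm: "sublinear norm"
  by (simp add: sublinear_def norm_triangle_ineq)

text \<open>
  The largest sublinear functional below \<open>q\<close> whose value at \<open>- y\<close> is at most \<open>- q y\<close>. If \<open>q\<close> is
  minimal, tilting cannot change it, which forces \<open>q (- y) = - q y\<close>; if \<open>q\<close> is the norm, any linear
  functional below the tilted one attains the norm at \<open>y\<close>.
\<close>

definition tilt :: "('a::real_vector \<Rightarrow> real) \<Rightarrow> 'a \<Rightarrow> 'a \<Rightarrow> real"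
  where "tilt q y x = (INF t\<in>{0..}. q (x + t *\<^sub>R y) - t * q y)"

context
  fixes q :: "'a::real_vector \<Rightarrow> real" and y :: 'a
  assumes q: "sublinear q"
begin

lemma tilt_lower: "0 \<le> t \<Longrightarrow> tilt q y x \<le> q (x + t *\<^sub>R y) - t * q y"
proof -
  have "- q (- x) \<le> q (x + s *\<^sub>R y) - s * q y" if "0 \<le> s" for s
    using sublinear_add[OF q, of "x + s *\<^sub>R y" "- x"] sublinear_scaleR[OF q that, of y] by simp
  then have "bdd_below ((\<lambda>t. q (x + t *\<^sub>R y) - t * q y) ` {0..})"
    by (auto intro!: bdd_belowI)
  then show "0 \<le> t \<Longrightarrow> tilt q y x \<le> q (x + t *\<^sub>R y) - t * q y"
    unfolding tilt_def by (auto intro: cINF_lower)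
qed

lemma tilt_greatest: "(\<And>t. 0 \<le> t \<Longrightarrow> c \<le> q (x + t *\<^sub>R y) - t * q y) \<Longrightarrow> c \<le> tilt q y x"
  unfolding tilt_def by (auto intro!: cINF_greatest)

lemma tilt_le: "tilt q y x \<le> q x"
  using tilt_lower[of 0 x] by simp

lemma tilt_uminus: "tilt q y (- y) \<le> - q y"
  using tilt_lower[of 1 "- y"] sublinear_zero[OF q] by simp

lemma sublinear_tilt: "sublinear (tilt q y)"
proof (rule sublinearI)
  fix u v
  have split: "tilt q y (u + v) \<le>
      (q (u + s *\<^sub>R y) - s * q y) + (q (v + t *\<^sub>R y) - t * q y)" if "0 \<le> s" "0 \<le> t" for s t
    using tilt_lower[of "s + t" "u + v"] that
      sublinear_add[OF q, of "u + s *\<^sub>R y" "v + t *\<^sub>R y"]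
    by (simp add: algebra_simps)
  have "tilt q y (u + v) - (q (v + t *\<^sub>R y) - t * q y) \<le> tilt q y u" if "0 \<le> t" for t
    by (rule tilt_greatest) (use split[OF _ that] in \<open>simp add: algebra_simps\<close>)
  then have "tilt q y (u + v) - tilt q y u \<le> tilt q y v"
    by (intro tilt_greatest) (simp add: algebra_simps)
  then show "tilt q y (u + v) \<le> tilt q y u + tilt q y v" by simp
next
  have "0 \<le> tilt q y 0"
    by (rule tilt_greatest) (simp add: sublinear_scaleR[OF q])
  with tilt_le[of 0] sublinear_zero[OF q] show "tilt q y 0 = 0" by simp
next
  fix c :: real and x assume c: "0 < c"
  have "tilt q y (c *\<^sub>R x) / c \<le> tilt q y x"
  proof (rule tilt_greatest)
    fix t :: real assume t: "0 \<le> t"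
    have "tilt q y (c *\<^sub>R x) \<le> q (c *\<^sub>R (x + t *\<^sub>R y)) - (c * t) * q y"
      using tilt_lower[of "c * t" "c *\<^sub>R x"] c t by (simp add: scaleR_add_right)
    also have "\<dots> = c * (q (x + t *\<^sub>R y) - t * q y)"
      using sublinear_scaleR[OF q, of c "x + t *\<^sub>R y"] c
      by (simp only: less_imp_le right_diff_distrib mult.assoc)
    finally show "tilt q y (c *\<^sub>R x) / c \<le> q (x + t *\<^sub>R y) - t * q y"
      using c by (simp add: field_simps)
  qed
  then show "tilt q y (c *\<^sub>R x) \<le> c * tilt q y x"
    using c by (simp add: field_simps)
qed

end

text \<open>
  The bound \<open>- p (- x) \<le> q x\<close>, common to all sublinear \<open>q \<le> p\<close>, keeps the infimum finite.
  Subadditivity mixes the values of two members \<open>q\<close> and \<open>r\<close> of the family; since these are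
  comparable, the smaller of the two serves at both points.
\<close>

lemma sublinear_INF_chain:
  fixes C :: "('a::real_vector \<Rightarrow> real) set"
  assumes "C \<noteq> {}"
    and sub: "\<And>q. q \<in> C \<Longrightarrow> sublinear q"
    and dom: "\<And>q. q \<in> C \<Longrightarrow> q \<le> p"
    and chain: "\<And>q r. q \<in> C \<Longrightarrow> r \<in> C \<Longrightarrow> q \<le> r \<or> r \<le> q"
  defines "I \<equiv> (\<lambda>x. INF q\<in>C. q x)"
  shows "sublinear I" and "\<And>q. q \<in> C \<Longrightarrow> I \<le> q"
proof -
  have "- p (- x) \<le> q x" if "q \<in> C" for q x
    using sublinear_minus[OF sub[OF that], of x] le_funD[OF dom[OF that], of "- x"] by simp
  then have "bdd_below ((\<lambda>q. q x) ` C)" for x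
    by (auto intro!: bdd_belowI)
  then have lower: "I x \<le> q x" if "q \<in> C" for q x
    unfolding I_def using that by (auto intro: cINF_lower)
  have greatest: "c \<le> I x" if "\<And>q. q \<in> C \<Longrightarrow> c \<le> q x" for c x
    unfolding I_def using \<open>C \<noteq> {}\<close> that by (auto intro!: cINF_greatest)
  show "I \<le> q" if "q \<in> C" for q
    using lower[OF that] by (simp add: le_fun_def)
  show "sublinear I"
  proof (rule sublinearI)
    fix u v
    have split: "I (u + v) \<le> q u + r v" if "q \<in> C" "r \<in> C" for q r
      using chain[OF that]
    proof
      assume "q \<le> r"
      then show ?thesis
        using lower[OF that(1), of "u + v"] sublinear_add[OF sub[OF that(1)], of u v] le_funD[of q r v]
        by simp
    next
      assume "r \<le> q"
      then show ?thesis
        using lower[OF that(2), of "u + v"] sublinear_add[OF sub[OF that(2)], of u v] le_funD[of r q u]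
        by simp
    qed
    have "I (u + v) - r v \<le> I u" if "r \<in> C" for r
      by (rule greatest) (use split[OF _ that] in \<open>simp add: algebra_simps\<close>)
    then have "I (u + v) - I u \<le> I v"
      by (intro greatest) (simp add: algebra_simps)
    then show "I (u + v) \<le> I u + I v" by simp
  next
    show "I 0 = 0"
      using \<open>C \<noteq> {}\<close> by (simp add: I_def sublinear_zero[OF sub] cong: INF_cong)
  next
    fix c :: real and x assume c: "0 < c"
    have "I (c *\<^sub>R x) / c \<le> I x"
    proof (rule greatest)
      fix q assume "q \<in> C"
      then show "I (c *\<^sub>R x) / c \<le> q x"
        using lower[of q "c *\<^sub>R x"] sublinear_scaleR[OF sub, of q c x] c by (simp add: field_simps)
    qed
    then show "I (c *\<^sub>R x) \<le> c * I x"
      using c by (simp add: field_simps)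
  qed
qed

text \<open>
  Zorn's lemma gives a minimal sublinear functional below \<open>p\<close>. Minimality under tilting makes it odd,
  and an odd sublinear functional is linear. Working with everywhere defined functionals avoids
  extending partially defined linear maps.
\<close>

theorem hahn_banach_sublinear:
  fixes p :: "'a::real_vector \<Rightarrow> real"
  assumes p: "sublinear p"
  obtains g where "linear g" and "\<And>x. g x \<le> p x"
proof -
  let ?A = "{q. sublinear q \<and> q \<le> p}"
  let ?P = "\<lambda>q r. r \<le> q"
  have "\<exists>q\<in>?A. \<forall>r\<in>?A. ?P q r \<longrightarrow> r = q"
  proof (rule predicate_Zorn)
    show "partial_order_on ?A (relation_of ?P ?A)"
      by (rule partial_order_on_relation_ofI) auto
  next
    fix C assume C: "C \<in> Chains (relation_of ?P ?A)"
    then have sub: "\<And>q. q \<in> C \<Longrightarrow> sublinear q" and dom: "\<And>q. q \<in> C \<Longrightarrow> q \<le> p"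
      and chain: "\<And>q r. q \<in> C \<Longrightarrow> r \<in> C \<Longrightarrow> q \<le> r \<or> r \<le> q"
      by (auto simp: Chains_def relation_of_def)
    show "\<exists>u\<in>?A. \<forall>q\<in>C. ?P q u"
    proof (cases "C = {}")
      case False
      let ?I = "\<lambda>x. INF q\<in>C. q x"
      have I: "sublinear ?I" "\<And>q. q \<in> C \<Longrightarrow> ?I \<le> q"
        using sublinear_INF_chain[OF False sub dom chain] by blast+
      obtain q where "q \<in> C" using False by blast
      then have "?I \<le> p" using I(2) dom order_trans by blast
      with I show ?thesis by (intro bexI[of _ ?I]) auto
    qed (use p in auto)
  qed
  then obtain q where q: "sublinear q" "q \<le> p"
    and minimal: "\<And>r. sublinear r \<Longrightarrow> r \<le> q \<Longrightarrow> r = q"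
    by (metis (mono_tags, lifting) mem_Collect_eq order_trans)
  have odd: "q (- y) = - q y" for y
  proof -
    have "tilt q y = q"
      by (rule minimal[OF sublinear_tilt[OF q(1)]]) (simp add: le_fun_def tilt_le[OF q(1)])
    then have "q (- y) \<le> - q y"
      using tilt_uminus[OF q(1), of y] by simp
    with sublinear_minus[OF q(1), of y] show ?thesis by simp
  qed
  have "linear q"
  proof (rule linearI)
    fix x y
    show "q (x + y) = q x + q y"
      using sublinear_add[OF q(1), of x y] sublinear_add[OF q(1), of "- x" "- y"]
        odd[of "x + y"] odd[of x] odd[of y] by simp
  next
    fix c :: real and x
    show "q (c *\<^sub>R x) = c *\<^sub>R q x"
    proof (cases "0 \<le> c")
      case False
      then show ?thesis
        using sublinear_scaleR[OF q(1), of "- c" x] odd[of "c *\<^sub>R x"] by simp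
    qed (simp add: sublinear_scaleR[OF q(1)])
  qed
  with that q(2) show ?thesis by (auto simp: le_fun_def)
qed

corollary norming_functional:
  fixes x :: "'a::real_normed_vector"
  obtains g :: "'a \<Rightarrow>\<^sub>L real" where "\<And>z. \<bar>blinfun_apply g z\<bar> \<le> norm z" and "blinfun_apply g x = norm x"
proof -
  obtain h where h: "linear h" "\<And>z. h z \<le> tilt norm x z"
    using hahn_banach_sublinear[OF sublinear_tilt[OF sublinear_norm, of x]] by blast
  have le: "h z \<le> norm z" for z
    using h(2)[of z] tilt_le[OF sublinear_norm, of x z] by linarith
  have bound: "\<bar>h z\<bar> \<le> norm z" for z
    using le[of z] le[of "- z"] linear_neg[OF h(1), of z] by simp
  have "bounded_linear h"
    using h(1) bound by (intro bounded_linear_intro[where K = 1]) (auto simp: linear_add linear_cmul)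
  moreover have "h x = norm x"
    using h(2)[of "- x"] tilt_uminus[OF sublinear_norm, of x] linear_neg[OF h(1), of x] le[of x] by simp
  ultimately show ?thesis
    using that[of "Blinfun h"] bound by (simp add: bounded_linear_Blinfun_apply)
qed


section \<open>Finite-dimensional subspaces\<close>

lemma closed_if_compact_Int_cballs:
  fixes E :: "'a::real_normed_vector set"
  assumes "\<And>R. compact (E \<inter> cball 0 R)"
  shows "closed E"
proof (unfold closed_sequential_limits, intro allI impI, elim conjE)
  fix x l assume x: "\<forall>n. x n \<in> E" and l: "x \<longlonglongrightarrow> l"
  obtain R where "\<And>n. norm (x n) \<le> R"
    using l convergent_imp_Bseq[of x] by (auto simp: convergent_def Bseq_def)
  with x have "\<And>n. x n \<in> E \<inter> cball 0 R" by simp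
  with compact_imp_closed[OF assms] l have "l \<in> E \<inter> cball 0 R"
    using closed_sequentially by blast
  then show "l \<in> E" by simp
qed

text \<open>
  A new vector \<open>y\<close> outside the closed subspace \<open>span S\<close> has positive distance \<open>d\<close> from it, so the
  coefficient of \<open>y\<close> in a vector of norm at most \<open>R\<close> is at most \<open>R / d\<close>. The ball is therefore a
  closed part of the sum of a compact ball of \<open>span S\<close> and a segment.
\<close>

lemma compact_span_Int_cball:
  fixes S :: "'a::real_normed_vector set"
  assumes "finite S"
  shows "compact (span S \<inter> cball 0 R)"
  using assms
proof (induction S arbitrary: R rule: finite_induct)
  case empty
  have "compact ({0} \<inter> cball 0 R :: 'a set)"
    by (rule compact_Int_closed) auto
  then show ?case by simp
next
  case (insert y S)
  show ?case
  proof (cases "y \<in> span S")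
    case True
    then show ?thesis using insert.IH by (simp add: span_redundant)
  next
    case False
    define d where "d = infdist y (span S)"
    have d: "0 < d"
      unfolding d_def
      by (rule infdist_pos_not_in_closed[OF closed_if_compact_Int_cballs[OF insert.IH]])
        (use False span_zero in auto)
    have dist: "\<bar>t\<bar> * d \<le> norm (u + t *\<^sub>R y)" if "u \<in> span S" for u t
    proof (cases "t = 0")
      case False
      have "(- inverse t) *\<^sub>R u \<in> span S" using that by (rule span_scale)
      then have "d \<le> norm (y + inverse t *\<^sub>R u)"
        unfolding d_def using infdist_le by (metis dist_norm diff_minus_eq_add scaleR_minus_left)
      then have "\<bar>t\<bar> * d \<le> norm (t *\<^sub>R (y + inverse t *\<^sub>R u))"
        by (simp add: mult_left_mono)
      then show ?thesis using False by (simp add: scaleR_add_right add.commute)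
    qed simp
    define M where "M = R + R / d * norm y"
    let ?K = "{u + v | u v. u \<in> span S \<inter> cball 0 M \<and> v \<in> (\<lambda>t. t *\<^sub>R y) ` {- (R / d)..R / d}}"
    have "compact ((\<lambda>t. t *\<^sub>R y) ` {- (R / d)..R / d})"
      by (intro compact_continuous_image continuous_intros) auto
    then have "compact ?K"
      by (rule compact_sums[OF insert.IH])
    then have "compact (?K \<inter> cball 0 R)"
      by (rule compact_Int_closed[OF _ closed_cball])
    moreover have "span (insert y S) \<inter> cball 0 R = ?K \<inter> cball 0 R"
    proof (intro subset_antisym subsetI)
      fix z assume z: "z \<in> span (insert y S) \<inter> cball 0 R"
      then obtain t where t: "z - t *\<^sub>R y \<in> span S" by (auto simp: span_breakdown_eq)
      have "\<bar>t\<bar> * d \<le> R" using dist[OF t, of t] z by simp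
      then have tb: "\<bar>t\<bar> \<le> R / d" using d by (simp add: field_simps)
      have "norm (z - t *\<^sub>R y) \<le> norm z + \<bar>t\<bar> * norm y"
        using norm_triangle_ineq4[of z "t *\<^sub>R y"] by simp
      also have "\<dots> \<le> M" using z mult_right_mono[OF tb norm_ge_zero[of y]] by (simp add: M_def)
      finally have "z - t *\<^sub>R y \<in> span S \<inter> cball 0 M" using t by simp
      moreover have "t *\<^sub>R y \<in> (\<lambda>t. t *\<^sub>R y) ` {- (R / d)..R / d}" using tb by (intro imageI) auto
      moreover have "z = (z - t *\<^sub>R y) + t *\<^sub>R y" by simp
      ultimately have "z \<in> ?K" by blast
      with z show "z \<in> ?K \<inter> cball 0 R" by blast
    next
      fix z assume "z \<in> ?K \<inter> cball 0 R"
      then obtain u t where "u \<in> span S" "z = u + t *\<^sub>R y" "z \<in> cball 0 R" by auto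
      moreover from this have "z - t *\<^sub>R y \<in> span S" by simp
      ultimately show "z \<in> span (insert y S) \<inter> cball 0 R" unfolding span_breakdown_eq Int_iff by blast
    qed
    ultimately show ?thesis by simp
  qed
qed

section \<open>Basic subsequences of weakly null sequences\<close>

text \<open>
  If the inequality fails infinitely often, normalized counterexamples \<open>u k \<in> span S\<close> accumulate
  at a unit vector \<open>l\<close>. A functional norming \<open>l\<close> is nearly \<open>1\<close> at \<open>u k\<close> and nearly \<open>0\<close> at the
  perturbation \<open>s k *\<^sub>R y (n k)\<close>, because \<open>y\<close> is weakly null and the coefficients \<open>s k\<close> are bounded;
  so the norm of the perturbed vector cannot stay below \<open>c < 1\<close>.
\<close>

lemma mazur_finite_dimensional:
  fixes y :: "nat \<Rightarrow> 'a::real_normed_vector"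
  assumes "finite S"
    and unit: "\<And>n. norm (y n) = 1"
    and null: "limitin weak_topology y 0 sequentially"
    and c: "0 < c" "c < 1"
  shows "\<forall>\<^sub>F n in sequentially. \<forall>x\<in>span S. \<forall>t. c * norm x \<le> norm (x + t *\<^sub>R y n)"
proof (rule ccontr)
  assume "\<not> ?thesis"
  then have "\<forall>k. \<exists>n\<ge>k. \<exists>x\<in>span S. \<exists>t. norm (x + t *\<^sub>R y n) < c * norm x"
    by (auto simp: eventually_sequentially not_le)
  then obtain n x t where n: "\<And>k. k \<le> n k" and x: "\<And>k. x k \<in> span S"
    and close: "\<And>k. norm (x k + t k *\<^sub>R y (n k)) < c * norm (x k)"
    by metis
  define u where "u k = inverse (norm (x k)) *\<^sub>R x k" for k
  define s where "s k = inverse (norm (x k)) * t k" for k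
  have pos: "0 < norm (x k)" for k
    using le_less_trans[OF norm_ge_zero close[of k]] c(1) by (simp add: zero_less_mult_iff)
  have u: "u k \<in> span S" "norm (u k) = 1" for k
    using x pos[of k] by (auto simp: u_def span_scale)
  have near: "norm (u k + s k *\<^sub>R y (n k)) < c" for k
  proof -
    have "norm (u k + s k *\<^sub>R y (n k)) = norm (inverse (norm (x k)) *\<^sub>R (x k + t k *\<^sub>R y (n k)))"
      by (simp add: u_def s_def scaleR_add_right)
    also have "\<dots> = norm (x k + t k *\<^sub>R y (n k)) / norm (x k)"
      unfolding norm_scaleR by (simp add: divide_inverse mult.commute)
    finally show ?thesis using close[of k] pos[of k] by (simp add: pos_divide_less_eq)
  qed
  have sb: "\<bar>s k\<bar> \<le> 2" for k
    using norm_triangle_ineq4[of "u k + s k *\<^sub>R y (n k)" "u k"] near[of k] u(2)[of k] c(2)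
    by (simp add: unit)
  have "seq_compact (span S \<inter> cball 0 1)"
    by (rule compact_imp_seq_compact[OF compact_span_Int_cball[OF \<open>finite S\<close>]])
  moreover have "\<forall>k. u k \<in> span S \<inter> cball 0 1" using u by auto
  ultimately obtain l r where r: "strict_mono (r :: nat \<Rightarrow> nat)" and l: "(u \<circ> r) \<longlonglongrightarrow> l"
    by (rule seq_compactE)
  have "(\<lambda>k. norm ((u \<circ> r) k)) \<longlonglongrightarrow> norm l" by (intro tendsto_norm l)
  then have norm_l: "norm l = 1"
    using u(2) by (simp add: LIMSEQ_const_iff)
  obtain g :: "'a \<Rightarrow>\<^sub>L real" where g: "\<And>z. \<bar>blinfun_apply g z\<bar> \<le> norm z" "blinfun_apply g l = 1"
    using norming_functional[of l] norm_l by metis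
  have "filterlim (n \<circ> r) at_top sequentially"
  proof (rule filterlim_at_top_mono[OF filterlim_ident])
    show "\<forall>\<^sub>F k in sequentially. k \<le> (n \<circ> r) k"
      using n seq_suble[OF r] by (auto intro!: always_eventually intro: order_trans)
  qed
  moreover have "(\<lambda>k. blinfun_apply g (y k)) \<longlonglongrightarrow> 0"
    using null by (simp add: limitin_weak_topology_iff blinfun.zero_right)
  ultimately have gy: "(\<lambda>k. blinfun_apply g (y (n (r k)))) \<longlonglongrightarrow> 0"
    using filterlim_compose by (fastforce simp: o_def)
  have "(\<lambda>k. s (r k) * blinfun_apply g (y (n (r k)))) \<longlonglongrightarrow> 0"
  proof (rule Lim_null_comparison)
    show "\<forall>\<^sub>F k in sequentially. norm (s (r k) * blinfun_apply g (y (n (r k))))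
        \<le> 2 * \<bar>blinfun_apply g (y (n (r k)))\<bar>"
      using sb by (auto simp: abs_mult intro!: always_eventually mult_right_mono)
    show "(\<lambda>k. 2 * \<bar>blinfun_apply g (y (n (r k)))\<bar>) \<longlonglongrightarrow> 0"
      using tendsto_mult[OF tendsto_const[of 2] tendsto_rabs[OF gy]] by simp
  qed
  moreover have "(\<lambda>k. blinfun_apply g (u (r k))) \<longlonglongrightarrow> 1"
    using blinfun.tendsto[OF tendsto_const[of g] l] by (simp add: g(2) o_def)
  ultimately have "(\<lambda>k. blinfun_apply g (u (r k)) + s (r k) * blinfun_apply g (y (n (r k)))) \<longlonglongrightarrow> 1 + 0"
    by (intro tendsto_add)
  then have "1 + 0 \<le> c"
  proof (rule LIMSEQ_le_const2)
    have "blinfun_apply g (u (r k)) + s (r k) * blinfun_apply g (y (n (r k))) \<le> c" for k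
      using g(1)[of "u (r k) + s (r k) *\<^sub>R y (n (r k))"] near[of "r k"]
      by (simp add: blinfun.add_right blinfun.scaleR_right)
    then show "\<exists>N. \<forall>k\<ge>N. blinfun_apply g (u (r k)) + s (r k) * blinfun_apply g (y (n (r k))) \<le> c"
      by blast
  qed
  with c(2) show False by simp
qed

lemma span_range_eventually_partial_sum:
  fixes x :: "nat \<Rightarrow> 'a::real_vector"
  assumes "z \<in> span (range x)"
  shows "\<exists>a N. \<forall>n\<ge>N. (\<Sum>i<n. a i *\<^sub>R x i) = z"
proof -
  let ?T = "{z. \<exists>a N. \<forall>n\<ge>N. (\<Sum>i<n. a i *\<^sub>R x i) = z}"
  have "subspace ?T"
  proof (rule subspaceI)
    show "0 \<in> ?T" by (auto intro!: exI[of _ "\<lambda>_. 0"])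
  next
    fix u v assume "u \<in> ?T" "v \<in> ?T"
    then obtain a b M N where "\<forall>n\<ge>M. (\<Sum>i<n. a i *\<^sub>R x i) = u" "\<forall>n\<ge>N. (\<Sum>i<n. b i *\<^sub>R x i) = v"
      by auto
    then have "\<forall>n\<ge>max M N. (\<Sum>i<n. (a i + b i) *\<^sub>R x i) = u + v"
      by (simp add: scaleR_add_left sum.distrib)
    then have "\<exists>N. \<forall>n\<ge>N. (\<Sum>i<n. (a i + b i) *\<^sub>R x i) = u + v" by (rule exI)
    then have "\<exists>a N. \<forall>n\<ge>N. (\<Sum>i<n. a i *\<^sub>R x i) = u + v"
      by (rule exI[where x = "\<lambda>i. a i + b i"])
    then show "u + v \<in> ?T" by (rule CollectI)
  next
    fix c :: real and u assume "u \<in> ?T"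
    then obtain a N where "\<forall>n\<ge>N. (\<Sum>i<n. a i *\<^sub>R x i) = u" by auto
    then have "\<forall>n\<ge>N. (\<Sum>i<n. (c * a i) *\<^sub>R x i) = c *\<^sub>R u"
      by (simp flip: scaleR_scaleR scaleR_sum_right)
    then have "\<exists>N. \<forall>n\<ge>N. (\<Sum>i<n. (c * a i) *\<^sub>R x i) = c *\<^sub>R u" by (rule exI)
    then have "\<exists>a N. \<forall>n\<ge>N. (\<Sum>i<n. a i *\<^sub>R x i) = c *\<^sub>R u"
      by (rule exI[where x = "\<lambda>i. c * a i"])
    then show "c *\<^sub>R u \<in> ?T" by (rule CollectI)
  qed
  moreover have "range x \<subseteq> ?T"
  proof clarify
    fix j
    have "(\<Sum>i<n. (if i = j then 1 else 0) *\<^sub>R x i) = x j" if "Suc j \<le> n" for n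
    proof -
      have "(\<Sum>i<n. (if i = j then 1 else 0) *\<^sub>R x i) = (\<Sum>i<n. if i = j then x j else 0)"
        by (rule sum.cong) auto
      then show ?thesis using that by simp
    qed
    then have "\<exists>N. \<forall>n\<ge>N. (\<Sum>i<n. (if i = j then 1 else 0) *\<^sub>R x i) = x j" by blast
    then show "\<exists>a N. \<forall>n\<ge>N. (\<Sum>i<n. a i *\<^sub>R x i) = x j"
      by (rule exI[where x = "\<lambda>i. if i = j then 1 else 0"])
  qed
  ultimately have "span (range x) \<subseteq> ?T" by (intro span_minimal)
  with assms show ?thesis by blast
qed

text \<open>
  Domination of short partial sums by long ones makes each coefficient a Lipschitz function of the
  vector, uniformly on finite linear combinations. This gives uniqueness, and it lets the coefficients
  of approximating finite combinations converge. The same estimate, now for all partial sums at once,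
  shows that the series with the limiting coefficients converges to the limit of the approximants.
\<close>

theorem basic_sequence_if_partial_sums_dominated:
  fixes x :: "nat \<Rightarrow> 'a::real_normed_vector"
  assumes nz: "\<And>n. x n \<noteq> 0"
    and K: "\<And>a m n. m \<le> n \<Longrightarrow> norm (\<Sum>i<m. a i *\<^sub>R x i) \<le> K * norm (\<Sum>i<n. a i *\<^sub>R x i)"
  shows "basic_sequence x"
proof -
  let ?S = "\<lambda>a n. \<Sum>i<n. a i *\<^sub>R x i"
  have S_diff: "?S (\<lambda>i. a i - b i) n = ?S a n - ?S b n" for a b n
    by (simp add: scaleR_diff_left sum_subtractf)
  have coeff: "\<bar>a i\<bar> * norm (x i) \<le> 2 * C" if "\<And>m. norm (?S a m) \<le> C" for a i C
    using norm_triangle_ineq4[of "?S a (Suc i)" "?S a i"] that[of "Suc i"] that[of i] by simp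
  have unique: "a = b" if a: "(\<lambda>n. a n *\<^sub>R x n) sums y" and b: "(\<lambda>n. b n *\<^sub>R x n) sums y" for a b y
  proof
    fix i
    let ?d = "\<lambda>i. a i - b i"
    have "(\<lambda>n. ?S ?d n) \<longlonglongrightarrow> 0"
      unfolding S_diff using tendsto_diff[OF a[unfolded sums_def] b[unfolded sums_def]] by simp
    then have lim: "(\<lambda>n. K * norm (?S ?d n)) \<longlonglongrightarrow> 0"
      by (intro tendsto_mult_right_zero tendsto_norm_zero)
    have "norm (?S ?d m) \<le> 0" for m
      by (rule LIMSEQ_le_const[OF lim]) (intro exI[of _ m] allI impI K)
    from coeff[of ?d, OF this, of i] show "a i = b i"
      using nz[of i] by (simp add: mult_le_0_iff)
  qed
  have exists: "\<exists>a. (\<lambda>n. a n *\<^sub>R x n) sums y" if "y \<in> closure (span (range x))" for y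
  proof -
    obtain z where z: "\<And>k. z k \<in> span (range x)" and zy: "z \<longlonglongrightarrow> y"
      using \<open>y \<in> _\<close> by (auto simp: closure_sequential)
    obtain A N where AN: "\<And>k n. N k \<le> n \<Longrightarrow> ?S (A k) n = z k"
      using span_range_eventually_partial_sum[OF z] by metis
    \<comment> \<open>A partial sum long enough to contain both combinations is exactly \<open>z l - z k\<close>.\<close>
    have D: "norm (?S (\<lambda>i. A l i - A k i) m) \<le> K * norm (z l - z k)" for k l m
      using K[of m "max m (max (N k) (N l))" "\<lambda>i. A l i - A k i"] by (simp add: S_diff AN)
    have "Cauchy (\<lambda>k. A k i)" for i
    proof (rule CauchyI)
      fix e :: real assume "0 < e"
      \<comment> \<open>The summand \<open>1\<close> only keeps the divisor positive.\<close>
      let ?C = "2 * \<bar>K\<bar> / norm (x i) + 1"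
      have C: "0 < ?C" by (simp add: add_nonneg_pos)
      have "Cauchy z" using zy by (rule LIMSEQ_imp_Cauchy)
      then obtain M where M: "\<And>m n. M \<le> m \<Longrightarrow> M \<le> n \<Longrightarrow> norm (z m - z n) < e / ?C"
        using C \<open>0 < e\<close> by (metis CauchyD divide_pos_pos)
      have "norm (A m i - A n i) < e" if "M \<le> m" "M \<le> n" for m n
      proof -
        have "\<bar>A m i - A n i\<bar> * norm (x i) \<le> 2 * (K * norm (z m - z n))"
          using coeff[of "\<lambda>i. A m i - A n i", OF D] .
        also have "\<dots> \<le> 2 * \<bar>K\<bar> * norm (z m - z n)"
          using mult_right_mono[OF abs_ge_self[of K] norm_ge_zero] by simp
        finally have "\<bar>A m i - A n i\<bar> \<le> 2 * \<bar>K\<bar> / norm (x i) * norm (z m - z n)"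
          using nz[of i] by (simp add: field_simps)
        also have "\<dots> \<le> ?C * norm (z m - z n)"
          by (intro mult_right_mono) auto
        also have "\<dots> < e"
          using M[OF that] C by (simp add: pos_less_divide_eq mult.commute)
        finally show ?thesis by simp
      qed
      then show "\<exists>M. \<forall>m\<ge>M. \<forall>n\<ge>M. norm (A m i - A n i) < e" by blast
    qed
    then have "\<exists>b. (\<lambda>k. A k i) \<longlonglongrightarrow> b" for i
      by (metis real_Cauchy_convergent convergent_def)
    then obtain a where a: "\<And>i. (\<lambda>k. A k i) \<longlonglongrightarrow> a i" by metis
    have D_lim: "norm (?S (\<lambda>i. a i - A k i) m) \<le> K * norm (y - z k)" for k m
    proof (rule LIMSEQ_le)
      show "(\<lambda>l. norm (?S (\<lambda>i. A l i - A k i) m)) \<longlonglongrightarrow> norm (?S (\<lambda>i. a i - A k i) m)"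
        by (intro tendsto_intros a)
      show "(\<lambda>l. K * norm (z l - z k)) \<longlonglongrightarrow> K * norm (y - z k)"
        by (intro tendsto_intros zy)
    qed (intro exI[of _ 0] allI impI D)
    have "(\<lambda>m. ?S a m) \<longlonglongrightarrow> y"
    proof (rule LIMSEQ_I)
      fix e :: real assume "0 < e"
      have "(\<lambda>k. K * norm (y - z k) + norm (y - z k)) \<longlonglongrightarrow> K * norm (y - y) + norm (y - y)"
        by (intro tendsto_intros zy)
      then have "(\<lambda>k. K * norm (y - z k) + norm (y - z k)) \<longlonglongrightarrow> 0" by simp
      then have "\<forall>\<^sub>F k in sequentially. K * norm (y - z k) + norm (y - z k) < e"
        using \<open>0 < e\<close> by (rule order_tendstoD(2))
      then obtain k where k: "K * norm (y - z k) + norm (y - z k) < e"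
        using eventually_happens' trivial_limit_sequentially by blast
      have "norm (?S a m - y) < e" if "N k \<le> m" for m
      proof -
        have "?S a m - y = ?S (\<lambda>i. a i - A k i) m - (y - z k)"
          using that by (simp add: S_diff AN)
        then have "norm (?S a m - y) \<le> norm (?S (\<lambda>i. a i - A k i) m) + norm (y - z k)"
          by (simp only: norm_triangle_ineq4)
        then show ?thesis using D_lim[of k m] k by linarith
      qed
      then show "\<exists>no. \<forall>m\<ge>no. norm (?S a m - y) < e" by blast
    qed
    then show ?thesis by (auto simp: sums_def)
  qed
  show ?thesis
    unfolding basic_sequence_def schauder_basis_of_def
  proof (intro conjI ballI)
    show "range x \<subseteq> closure (span (range x))"
      by (meson closure_subset order_trans span_superset)
  next
    fix y assume "y \<in> closure (span (range x))"
    from exists[OF this] obtain a where a: "(\<lambda>n. a n *\<^sub>R x n) sums y" by blast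
    show "\<exists>!a. (\<lambda>n. a n *\<^sub>R x n) sums y"
      by (rule ex1I[where P = "\<lambda>a. (\<lambda>n. a n *\<^sub>R x n) sums y", OF a]) (rule unique[OF _ a])
  qed
qed

text \<open>
  Each new member is chosen by Mazur's lemma for the span of \<^emph>\<open>all\<close> earlier terms of \<open>y\<close> up to the last
  chosen index, so that a choice depends only on that index and not on the history of choices.
\<close>

theorem weakly_null_has_basic_subsequence:
  fixes y :: "nat \<Rightarrow> 'a::real_normed_vector"
  assumes unit: "\<And>n. norm (y n) = 1"
    and null: "limitin weak_topology y 0 sequentially"
  obtains r :: "nat \<Rightarrow> nat" where "strict_mono r" and "basic_sequence (y \<circ> r)"
proof -
  \<comment> \<open>The shrinking factors \<open>c k / c (Suc k) < 1\<close> have telescoping products, all at least \<open>1 / 2\<close>.\<close>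
  define c :: "nat \<Rightarrow> real" where "c k = 2 - 1 / (real k + 1)" for k
  have c: "1 \<le> c k" "c k \<le> 2" "c k < c (Suc k)" for k
    by (auto simp: c_def field_simps)
  let ?Q = "\<lambda>k m n. m < n \<and>
    (\<forall>x\<in>span (y ` {..m}). \<forall>t. c k * norm x \<le> c (Suc k) * norm (x + t *\<^sub>R y n))"
  have "\<exists>r. \<forall>k. True \<and> ?Q k (r k) (r (Suc k))"
  proof (rule dependent_nat_choice)
    fix m k :: nat
    have pos: "0 < c k" "0 < c (Suc k)" using c(1)[of k] c(1)[of "Suc k"] by linarith+
    have "\<forall>\<^sub>F n in sequentially.
        \<forall>x\<in>span (y ` {..m}). \<forall>t. c k / c (Suc k) * norm x \<le> norm (x + t *\<^sub>R y n)"
      by (rule mazur_finite_dimensional[OF _ unit null]) (use c(3)[of k] pos in auto)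
    then have "\<forall>\<^sub>F n in sequentially. m < n \<and>
        (\<forall>x\<in>span (y ` {..m}). \<forall>t. c k / c (Suc k) * norm x \<le> norm (x + t *\<^sub>R y n))"
      by (intro eventually_conj eventually_gt_at_top)
    then obtain n where n: "m < n"
      "\<And>x t. x \<in> span (y ` {..m}) \<Longrightarrow> c k / c (Suc k) * norm x \<le> norm (x + t *\<^sub>R y n)"
      using eventually_happens' trivial_limit_sequentially by blast
    then have "?Q k m n" using pos by (simp add: field_simps)
    then show "\<exists>n. True \<and> ?Q k m n" by blast
  qed simp
  then obtain r where r: "\<And>k. r k < r (Suc k)"
    and grow: "\<And>k x t. x \<in> span (y ` {..r k}) \<Longrightarrow>
      c k * norm x \<le> c (Suc k) * norm (x + t *\<^sub>R y (r (Suc k)))"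
    by blast
  have mono: "strict_mono r" using r by (simp add: strict_mono_Suc_iff)
  let ?S = "\<lambda>a n. \<Sum>i<n. a i *\<^sub>R (y \<circ> r) i"
  \<comment> \<open>The weighted norms of the nonempty partial sums increase; weights in the interval from \<open>1\<close> to \<open>2\<close>
    turn this into domination with constant \<open>2\<close>.\<close>
  have step: "c k * norm (?S a (Suc k)) \<le> c (Suc k) * norm (?S a (Suc (Suc k)))" for a k
  proof -
    have "y (r i) \<in> span (y ` {..r k})" if "i < Suc k" for i
      using that strict_mono_less_eq[OF mono] by (intro span_base) auto
    then have "?S a (Suc k) \<in> span (y ` {..r k})"
      by (intro span_sum span_scale) simp
    from grow[OF this, of "a (Suc k)"] show ?thesis by simp
  qed
  have "norm (?S a m) \<le> 2 * norm (?S a n)" if "m \<le> n" for a m n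
  proof (cases m)
    case (Suc j)
    with that obtain k where n: "n = Suc k" and jk: "j \<le> k" by (metis Suc_le_D Suc_le_mono)
    have "norm (?S a (Suc j)) \<le> c j * norm (?S a (Suc j))"
      using mult_right_mono[OF c(1)[of j] norm_ge_zero] by simp
    also have "\<dots> \<le> c k * norm (?S a (Suc k))"
      using lift_Suc_mono_le[of "\<lambda>k. c k * norm (?S a (Suc k))", OF step jk] .
    also have "\<dots> \<le> 2 * norm (?S a (Suc k))"
      by (rule mult_right_mono[OF c(2) norm_ge_zero])
    finally show ?thesis unfolding Suc n .
  qed simp
  moreover have "(y \<circ> r) n \<noteq> 0" for n using unit[of "r n"] by auto
  ultimately have "basic_sequence (y \<circ> r)"
    by (intro basic_sequence_if_partial_sums_dominated[where K = 2])
  with mono that show ?thesis by blast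
qed

section \<open>Weakly null sequences in weakly compact sets\<close>

lemma continuous_map_weak_topology:
  fixes g :: "'a::real_normed_vector \<Rightarrow>\<^sub>L real"
  shows "continuous_map weak_topology euclideanreal (blinfun_apply g)"
proof -
  have "continuous_map euclidean euclideanreal (\<lambda>\<phi> :: ('a \<Rightarrow>\<^sub>L real) \<Rightarrow> real. \<phi> g)"
    by (simp add: continuous_on_product_coordinates)
  from continuous_map_pullback[OF this, of UNIV "\<lambda>x h. blinfun_apply h x"]
  show ?thesis by (simp add: weak_topology_def o_def)
qed

text \<open>
  The part \<open>?L\<close> of \<open>K\<close> where \<open>\<bar>g\<bar> \<ge> e\<close> is weakly compact, so its image under \<open>f\<close> is closed, and
  it misses \<open>0\<close> because \<open>f\<close> vanishes on \<open>K\<close> at most at the origin. As \<open>f (y n)\<close> tends to \<open>0\<close>, the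
  sequence eventually avoids \<open>?L\<close>.
\<close>

lemma weakly_null_in_weakly_compact:
  fixes f :: "'a::real_normed_vector \<Rightarrow>\<^sub>L real"
  assumes K: "compactin weak_topology K"
    and pos: "\<And>x. x \<in> K \<Longrightarrow> x \<noteq> 0 \<Longrightarrow> 0 < blinfun_apply f x"
    and y: "\<And>n. y n \<in> K"
    and lim: "(\<lambda>n. blinfun_apply f (y n)) \<longlonglongrightarrow> 0"
  shows "limitin weak_topology y 0 sequentially"
  unfolding limitin_weak_topology_iff blinfun.zero_right
proof (intro allI LIMSEQ_I)
  fix g :: "'a \<Rightarrow>\<^sub>L real" and e :: real
  assume e: "0 < e"
  let ?L = "{x. e \<le> \<bar>blinfun_apply g x\<bar>} \<inter> K"
  have "closedin weak_topology {x \<in> topspace weak_topology. blinfun_apply g x \<in> {t. e \<le> \<bar>t\<bar>}}"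
    by (rule closedin_continuous_map_preimage[OF continuous_map_weak_topology])
      (auto intro!: closed_Collect_le continuous_intros)
  then have "compactin weak_topology ?L"
    using K by (simp add: closed_Int_compactin)
  then have "compactin euclideanreal (blinfun_apply f ` ?L)"
    using continuous_map_weak_topology by (rule image_compactin)
  then have comp: "closed (blinfun_apply f ` ?L)"
    by (simp add: compact_imp_closed)
  have "0 \<notin> blinfun_apply f ` ?L"
  proof
    assume "0 \<in> blinfun_apply f ` ?L"
    then obtain x where x: "x \<in> K" "blinfun_apply f x = 0" "e \<le> \<bar>blinfun_apply g x\<bar>" by auto
    then have "x = 0" using pos by fastforce
    with x(3) e show False by (simp add: blinfun.zero_right)
  qed
  with comp have "open (- blinfun_apply f ` ?L)" "0 \<in> - blinfun_apply f ` ?L" by auto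
  then have "\<forall>\<^sub>F n in sequentially. blinfun_apply f (y n) \<in> - blinfun_apply f ` ?L"
    using lim topological_tendstoD by blast
  then have "\<forall>\<^sub>F n in sequentially. norm (blinfun_apply g (y n) - 0) < e"
    by (rule eventually_mono) (use y in \<open>force simp: not_le\<close>)
  then show "\<exists>N. \<forall>n\<ge>N. norm (blinfun_apply g (y n) - 0) < e"
    by (simp add: eventually_sequentially)
qed

section \<open>Reflexive cones with an unbounded base\<close>

theorem theorem4p8:
  fixes P :: "'a::banach set" and f :: "'a \<Rightarrow>\<^sub>L real"
  assumes "reflexive_cone P"
    and "strictly_positive_on f P"
    and "\<not> bounded (cone_base f P)"
  shows "\<exists>x :: nat \<Rightarrow> 'a. range x \<subseteq> P \<and> (\<forall>n. norm (x n) = 1) \<and> basic_sequence x \<and>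
    limitin weak_topology x 0 sequentially"
proof -
  have "\<exists>b\<in>cone_base f P. real n + 1 < norm b" for n
    using assms(3) by (meson bounded_iff not_le)
  then obtain b where b: "\<And>n. b n \<in> P" "\<And>n. blinfun_apply f (b n) = 1"
    and large: "\<And>n. real n + 1 < norm (b n)"
    by (auto simp: cone_base_def) metis
  define y where "y n = inverse (norm (b n)) *\<^sub>R b n" for n
  have cone: "conic P" and K: "compactin weak_topology (P \<inter> cball 0 1)"
    using assms(1) by (auto simp: reflexive_cone_def convex_cone_def)
  have yP: "y n \<in> P" for n
    unfolding y_def by (rule conicD[OF cone b(1)]) simp
  have unit: "norm (y n) = 1" for n
  proof -
    have "0 < norm (b n)" using large[of n] of_nat_0_le_iff[of n] by linarith
    then show ?thesis by (simp add: y_def)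
  qed
  have fy: "blinfun_apply f (y n) = inverse (norm (b n))" for n
    by (simp add: y_def blinfun.scaleR_right b(2))
  have "(\<lambda>n. blinfun_apply f (y n)) \<longlonglongrightarrow> 0"
  proof (rule tendsto_sandwich[OF _ _ tendsto_const LIMSEQ_inverse_real_of_nat])
    show "\<forall>\<^sub>F n in sequentially. blinfun_apply f (y n) \<le> inverse (real (Suc n))"
    proof (intro always_eventually allI)
      fix n
      have "real (Suc n) \<le> norm (b n)" using large[of n] by simp
      then show "blinfun_apply f (y n) \<le> inverse (real (Suc n))"
        unfolding fy by (rule le_imp_inverse_le) simp
    qed
  qed (simp add: fy)
  then have null: "limitin weak_topology y 0 sequentially"
    using assms(2) yP unit
    by (intro weakly_null_in_weakly_compact[OF K, of f]) (auto simp: strictly_positive_on_def)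
  obtain r where r: "strict_mono r" "basic_sequence (y \<circ> r)"
    using weakly_null_has_basic_subsequence[OF unit null] by blast
  have "limitin weak_topology (y \<circ> r) 0 sequentially"
    unfolding limitin_weak_topology_iff
  proof
    fix g :: "'a \<Rightarrow>\<^sub>L real"
    have "(\<lambda>n. blinfun_apply g (y n)) \<longlonglongrightarrow> blinfun_apply g 0"
      using null by (simp add: limitin_weak_topology_iff)
    from LIMSEQ_subseq_LIMSEQ[OF this r(1)]
    show "(\<lambda>n. blinfun_apply g ((y \<circ> r) n)) \<longlonglongrightarrow> blinfun_apply g 0"
      by (simp add: o_def)
  qed
  with r(2) yP unit show ?thesis
    by (intro exI[of _ "y \<circ> r"]) auto
qed

end
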